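(* An involutive BE algebra $X$ is an implicative-orthomodular algebra if and only if for all $x,y,z\in X$: $$x\to (y\Cap (x\to z)^* )=(x\to y)\Cap (x\to (x\to z)^* ).$$
   Context: A BE algebra is an algebra $(X,\to,1)$ of type $(2,0)$ such that for all $x,y,z\in X$: $x\to x=1$; $x\to 1=1$; $1\to x=x$; $x\to (y\to z)=y\to (x\to z)$. Write $x\le y$ iff $x\to y=1$. It is bounded if there is $0\in X$ with $0\le x$ for all $x\in X$; then $x^*:=x\to 0$. It is involutive if it is bounded and $x^{**}=x$ for all $x\in X$; an involutive BE algebra is denoted $(X,\to,^*,1)$. In an involutive BE algebra define $x\Cap y=((x^*\to y^* )\to y^* )^*$. An implicative-orthomodular algebra is an involutive BE algebra satisfying $x\to (y\Cap (z\Cap x))=(x\to y)\Cap (x\to z)$ for all $x,y,z\in X$. *)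

theory Defs
  imports Main
begin

locale BE_algebra =
  fixes imp :: "'a \<Rightarrow> 'a \<Rightarrow> 'a"  (infixr \<open>\<rightarrow>\<close> 65)
    and one :: "'a"  (\<open>\<one>\<close>)
  assumes imp_self: "x \<rightarrow> x = \<one>"
    and imp_one: "x \<rightarrow> \<one> = \<one>"
    and one_imp: "\<one> \<rightarrow> x = x"
    and imp_exchange: "x \<rightarrow> (y \<rightarrow> z) = y \<rightarrow> (x \<rightarrow> z)"
begin

definition le :: "'a \<Rightarrow> 'a \<Rightarrow> bool"  (infix \<open>\<preceq>\<close> 50)
  where "x \<preceq> y \<longleftrightarrow> x \<rightarrow> y = \<one>"

end

text \<open>The relation \<open>\<preceq>\<close> need not be antisymmetric, so a BE algebra may have several least
  elements; the locale fixes one of them. In the involutive case below it is determined by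
  \<open>\<rightarrow>\<close> and \<open>\<one>\<close>: if \<open>z\<close> is also a least element, then \<open>z\<^sup>\<star> = \<one>\<close>, hence
  \<open>z = z\<^sup>\<star>\<^sup>\<star> = \<one> \<rightarrow> \<zero> = \<zero>\<close>.\<close>

locale bounded_BE_algebra = BE_algebra imp one
  for imp :: "'a \<Rightarrow> 'a \<Rightarrow> 'a"  (infixr \<open>\<rightarrow>\<close> 65)
    and one :: "'a"  (\<open>\<one>\<close>) +
  fixes zero :: "'a"  (\<open>\<zero>\<close>)
  assumes zero_le: "\<zero> \<preceq> x"
begin

definition star :: "'a \<Rightarrow> 'a"  (\<open>_\<^sup>\<star>\<close> [1000] 1000)
  where "x\<^sup>\<star> = x \<rightarrow> \<zero>"

definition cap :: "'a \<Rightarrow> 'a \<Rightarrow> 'a"  (infixl \<open>\<Cap>\<close> 70)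
  where "x \<Cap> y = ((x\<^sup>\<star> \<rightarrow> y\<^sup>\<star>) \<rightarrow> y\<^sup>\<star>)\<^sup>\<star>"

end

locale involutive_BE_algebra = bounded_BE_algebra imp one zero
  for imp :: "'a \<Rightarrow> 'a \<Rightarrow> 'a"  (infixr \<open>\<rightarrow>\<close> 65)
    and one :: "'a"  (\<open>\<one>\<close>)
    and zero :: "'a"  (\<open>\<zero>\<close>) +
  assumes star_star: "x\<^sup>\<star>\<^sup>\<star> = x"

locale implicative_orthomodular_algebra = involutive_BE_algebra imp one zero
  for imp :: "'a \<Rightarrow> 'a \<Rightarrow> 'a"  (infixr \<open>\<rightarrow>\<close> 65)
    and one :: "'a"  (\<open>\<one>\<close>)
    and zero :: "'a"  (\<open>\<zero>\<close>) +
  assumes imp_cap: "x \<rightarrow> (y \<Cap> (z \<Cap> x)) = (x \<rightarrow> y) \<Cap> (x \<rightarrow> z)"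

text \<open>The operations \<open>\<^sup>\<star>\<close> and \<open>\<Cap>\<close> of given \<open>imp\<close> and \<open>zero\<close>, for use outside the locales.\<close>

abbreviation BE_star :: "('a \<Rightarrow> 'a \<Rightarrow> 'a) \<Rightarrow> 'a \<Rightarrow> 'a \<Rightarrow> 'a"
  where "BE_star \<equiv> bounded_BE_algebra.star"

abbreviation BE_cap :: "('a \<Rightarrow> 'a \<Rightarrow> 'a) \<Rightarrow> 'a \<Rightarrow> 'a \<Rightarrow> 'a \<Rightarrow> 'a"
  where "BE_cap \<equiv> bounded_BE_algebra.cap"

end

theory Submission
  imports Defs
begin

text \<open>In an involutive BE algebra \<open>z \<Cap> x = (x \<rightarrow> (x \<rightarrow> z)\<^sup>\<star>)\<^sup>\<star>\<close>, so the elements \<open>z \<Cap> x\<close> have the form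
  \<open>(x \<rightarrow> w)\<^sup>\<star>\<close>. Each of the two identities yields \<open>x \<rightarrow> (z \<Cap> x) = x \<rightarrow> z\<close>: the orthomodular one
  at \<open>y = \<one>\<close>, the other at \<open>z = \<zero>\<close>. By this law \<open>(x \<rightarrow> z)\<^sup>\<star> \<Cap> x = (x \<rightarrow> z)\<^sup>\<star>\<close>, hence the elements
  \<open>(x \<rightarrow> w)\<^sup>\<star>\<close> are exactly the elements \<open>z \<Cap> x\<close>, and the two identities translate into each other.\<close>

context involutive_BE_algebra
begin

text \<open>Expand \<open>y\<^sup>\<star>\<close> as \<open>y \<rightarrow> \<zero>\<close>,
  exchange the premises and cancel the double star.\<close>

lemma star_imp_star: "x\<^sup>\<star> \<rightarrow> y\<^sup>\<star> = y \<rightarrow> x"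
  by (metis star_def imp_exchange star_star)

lemma imp_star_commute: "x \<rightarrow> y\<^sup>\<star> = y \<rightarrow> x\<^sup>\<star>"
  by (simp add: star_def imp_exchange)

lemma cap_eq: "x \<Cap> y = (y \<rightarrow> (y \<rightarrow> x)\<^sup>\<star>)\<^sup>\<star>"
  unfolding cap_def star_imp_star by (subst imp_star_commute) (rule refl)

lemma one_cap: "\<one> \<Cap> x = x"
  by (metis cap_eq star_def imp_one one_imp star_star)

lemma cap_one: "x \<Cap> \<one> = x"
  by (simp add: cap_eq one_imp star_star)

lemma imp_cap_imp_star_if_imp_cap:
  assumes imp_cap: "\<And>x y z. x \<rightarrow> (y \<Cap> (z \<Cap> x)) = (x \<rightarrow> y) \<Cap> (x \<rightarrow> z)"
  shows "x \<rightarrow> (y \<Cap> (x \<rightarrow> z)\<^sup>\<star>) = (x \<rightarrow> y) \<Cap> (x \<rightarrow> (x \<rightarrow> z)\<^sup>\<star>)"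
proof -
  have "x \<rightarrow> (z \<Cap> x) = x \<rightarrow> z"
    using imp_cap[of x \<one> z] by (simp add: imp_one one_cap)
  \<comment> \<open>By \<open>cap_eq\<close> the left side is
    \<open>(x \<rightarrow> (z \<Cap> x))\<^sup>\<star>\<close>.\<close>
  then have "(x \<rightarrow> z)\<^sup>\<star> \<Cap> x = (x \<rightarrow> z)\<^sup>\<star>"
    by (simp add: cap_eq)
  then show ?thesis
    using imp_cap[of x y "(x \<rightarrow> z)\<^sup>\<star>"] by simp
qed

lemma imp_cap_if_imp_cap_imp_star:
  assumes imp_cap_imp_star:
    "\<And>x y z. x \<rightarrow> (y \<Cap> (x \<rightarrow> z)\<^sup>\<star>) = (x \<rightarrow> y) \<Cap> (x \<rightarrow> (x \<rightarrow> z)\<^sup>\<star>)"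
  shows "x \<rightarrow> (y \<Cap> (z \<Cap> x)) = (x \<rightarrow> y) \<Cap> (x \<rightarrow> z)"
proof -
  \<comment> \<open>Hence at \<open>z = \<zero>\<close> the second factor on the right is
    \<open>x \<rightarrow> x = \<one>\<close>, which \<open>cap_one\<close> removes.\<close>
  have "(x \<rightarrow> \<zero>)\<^sup>\<star> = x"
    using star_star[of x] by (simp add: star_def)
  then have "x \<rightarrow> (z \<Cap> x) = x \<rightarrow> z"
    using imp_cap_imp_star[of x z \<zero>] by (simp add: imp_self cap_one)
  \<comment> \<open>With \<open>(x \<rightarrow> z)\<^sup>\<star>\<close> in place of
    \<open>z\<close>, the starred term is \<open>z \<Cap> x\<close>; on the right the law reduces
    \<open>x \<rightarrow> (z \<Cap> x)\<close>.\<close>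
  then show ?thesis
    using imp_cap_imp_star[of x y "(x \<rightarrow> z)\<^sup>\<star>"] by (simp add: cap_eq)
qed

end

theorem theorem3p12:
  fixes imp :: "'a \<Rightarrow> 'a \<Rightarrow> 'a"  (infixr \<open>\<rightarrow>\<close> 65)
    and one zero :: "'a"
  assumes "involutive_BE_algebra imp one zero"
  shows "implicative_orthomodular_algebra imp one zero \<longleftrightarrow>
    (\<forall>x y z.
      x \<rightarrow> BE_cap imp zero y (BE_star imp zero (x \<rightarrow> z)) =
      BE_cap imp zero (x \<rightarrow> y) (x \<rightarrow> BE_star imp zero (x \<rightarrow> z)))"
proof -
  interpret involutive_BE_algebra imp one zero by fact
  show ?thesis
    unfolding implicative_orthomodular_algebra_def implicative_orthomodular_algebra_axioms_def
    using assms imp_cap_imp_star_if_imp_cap imp_cap_if_imp_cap_imp_star by blast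
qed

end
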